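(* Let $n\ge2$ and let $\overline n$ be the smallest integer $\ge n$ for which a Hadamard matrix of order $\overline n$ is known. Consider $n$ qubits (spins) with Hamiltonians $$\mathcal H_Z=-\tfrac12\sum_i\omega_iZ^{(i)},\qquad \mathcal H_c=\sum_{i<j}g_{ij}Z^{(i)}\otimes Z^{(j)} ,$$ with $\omega_i$, $g_{ij}$ real. Then $\overline n<2n$, and the following hold. (a) (Decoupling) Let $S$ be any $n\times\overline n$ matrix formed by choosing $n$ rows of a known Hadamard matrix of order $\overline n$. Concatenate $\overline n$ evolutions $e^{-i\mathcal H_ct}$ of equal, arbitrary duration $t$ and, for each entry $-1$ of $S$ in row $k$ and column $a$, apply $X^{(k)}$ before and after the $a$-th evolution. The resulting sequence is the identity. It uses $\overline n$ time intervals and, after cancelling adjacent pairs $X^{(k)}X^{(k)}=I$, at most $n\overline n$ pulses $X^{(k)}$. (b) (Removing both Hamiltonians) If $n<\overline n$, and in (a) the Hadamard matrix is normalized and its first row is not among the chosen rows, then the same sequence with $e^{-i(\mathcal H_Z+\mathcal H_c)t}$ in place of $e^{-i\mathcal H_ct}$ is the identity. If $n=\overline n$, the same construction works starting from a normalized Hadamard matrix of order $\overline{n+1}$, the smallest integer $\ge n+1$ for which a Hadamard matrix of that order is known. (c) (Selective recoupling) Let $i<j$ with $g_{ij}\ne0$. Let $S$ be an $n\times\overline n$ matrix whose $i$-th and $j$-th rows are both equal to the second row of a normalized Hadamard matrix of order $\overline n$, and whose other $n-2$ rows are distinct rows chosen from its remaining $\overline n-2$ rows (the first row being excluded). Construct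 the sequence from $S$ as in (a), with evolutions $e^{-i(\mathcal H_Z+\mathcal H_c)t}$ of equal duration $t$ satisfying $g_{ij}\overline n t=\pi/4$. The resulting operation is $e^{-i\frac{\pi}{4}Z^{(i)}\otimes Z^{(j)}}$. The scheme uses no more than $\overline n$ time intervals and at most $n\overline n$ pulses.
   Context: $X$ and $Z$ are the Pauli matrices $\sigma_x,\sigma_z$; $X^{(k)}$ and $Z^{(k)}$ denote the operator acting on qubit $k$ (identity on the others). A Hadamard matrix of order $N$ is an $N\times N$ matrix $H$ with entries $\pm1$ and $HH^T=NI$; it is normalized if its first row and first column consist only of $+1$'s (any Hadamard matrix can be normalized by negating rows and columns). "Known" means that a Hadamard matrix of that order has been constructed; in particular the orders $2^r$ are known, by Sylvester's tensor-power construction. *)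

theory Defs
  imports Complex_Main "Jordan_Normal_Form.Matrix"
begin

section \<open>Operators on \<open>n\<close> qubits\<close>

text \<open>Qubits, matrix rows and matrix columns are numbered from \<open>0\<close>.\<close>

definition kron :: "'a::semiring_1 mat \<Rightarrow> 'a mat \<Rightarrow> 'a mat" where
  "kron A B = mat (dim_row A * dim_row B) (dim_col A * dim_col B)
     (\<lambda>(r, c). A $$ (r div dim_row B, c div dim_col B) * B $$ (r mod dim_row B, c mod dim_col B))"

text \<open>\<open>tensor n A\<close> is \<open>A 0 \<otimes> A 1 \<otimes> \<dots> \<otimes> A (n - 1)\<close>.\<close>

fun tensor :: "nat \<Rightarrow> (nat \<Rightarrow> 'a::semiring_1 mat) \<Rightarrow> 'a mat" where
  "tensor 0 A = 1\<^sub>m 1"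
| "tensor (Suc n) A = kron (tensor n A) (A n)"

definition pauli_X :: "complex mat" where
  "pauli_X = mat_of_rows_list 2 [[0, 1], [1, 0]]"

definition pauli_Z :: "complex mat" where
  "pauli_Z = mat_of_rows_list 2 [[1, 0], [0, -1]]"

definition X_on :: "nat \<Rightarrow> nat \<Rightarrow> complex mat" where
  "X_on n k = tensor n (\<lambda>l. if l = k then pauli_X else 1\<^sub>m 2)"

definition Z_on :: "nat \<Rightarrow> nat \<Rightarrow> complex mat" where
  "Z_on n k = tensor n (\<lambda>l. if l = k then pauli_Z else 1\<^sub>m 2)"

definition ZZ_on :: "nat \<Rightarrow> nat \<Rightarrow> nat \<Rightarrow> complex mat" where
  "ZZ_on n i j = tensor n (\<lambda>l. if l = i \<or> l = j then pauli_Z else 1\<^sub>m 2)"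

definition matsum :: "nat \<Rightarrow> ('b \<Rightarrow> 'a::comm_monoid_add mat) \<Rightarrow> 'b set \<Rightarrow> 'a mat" where
  "matsum d f I = mat d d (\<lambda>rc. \<Sum>x\<in>I. f x $$ rc)"

definition ham_Z :: "nat \<Rightarrow> (nat \<Rightarrow> real) \<Rightarrow> complex mat" where
  "ham_Z n \<omega> = complex_of_real (- 1 / 2) \<cdot>\<^sub>m
     matsum (2 ^ n) (\<lambda>i. complex_of_real (\<omega> i) \<cdot>\<^sub>m Z_on n i) {..<n}"

definition ham_c :: "nat \<Rightarrow> (nat \<Rightarrow> nat \<Rightarrow> real) \<Rightarrow> complex mat" where
  "ham_c n g = matsum (2 ^ n) (\<lambda>(i, j). complex_of_real (g i j) \<cdot>\<^sub>m ZZ_on n i j)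
     {(i, j). i < j \<and> j < n}"

text \<open>The exponential series of a square matrix, summed entrywise.\<close>

definition mat_exp :: "complex mat \<Rightarrow> complex mat" where
  "mat_exp A = mat (dim_row A) (dim_row A) (\<lambda>rc. \<Sum>k. (A ^\<^sub>m k) $$ rc / fact k)"

definition evolution :: "complex mat \<Rightarrow> real \<Rightarrow> complex mat" where
  "evolution Ham t = mat_exp ((- \<i> * complex_of_real t) \<cdot>\<^sub>m Ham)"

section \<open>Hadamard matrices\<close>

definition hadamard :: "nat \<Rightarrow> int mat \<Rightarrow> bool" where
  "hadamard N H \<longleftrightarrow> H \<in> carrier_mat N N \<and>
     (\<forall>r<N. \<forall>c<N. H $$ (r, c) \<in> {1, -1}) \<and>
     H * transpose_mat H = int N \<cdot>\<^sub>m 1\<^sub>m N"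

definition normalized_hadamard :: "nat \<Rightarrow> int mat \<Rightarrow> bool" where
  "normalized_hadamard N H \<longleftrightarrow> hadamard N H \<and>
     (\<forall>c<N. H $$ (0, c) = 1) \<and> (\<forall>r<N. H $$ (r, 0) = 1)"

definition sylvester :: "nat \<Rightarrow> int mat" where
  "sylvester r = tensor r (\<lambda>_. mat_of_rows_list 2 [[1, 1], [1, -1]])"

text \<open>\<open>K\<close> stands for the collection of matrices that have been constructed.\<close>

definition known_order :: "int mat set \<Rightarrow> nat \<Rightarrow> bool" where
  "known_order K N \<longleftrightarrow> (\<exists>H\<in>K. hadamard N H)"

definition nbar :: "int mat set \<Rightarrow> nat \<Rightarrow> nat" where
  "nbar K n = (LEAST N. n \<le> N \<and> known_order K N)"

definition choose_rows :: "nat \<Rightarrow> nat \<Rightarrow> int mat \<Rightarrow> (nat \<Rightarrow> nat) \<Rightarrow> int mat" where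
  "choose_rows n N H f = mat n N (\<lambda>(k, a). H $$ (f k, a))"

text \<open>All \<open>n \<times> N\<close> matrices formed by \<open>n\<close> different rows of \<open>H\<close>, in any order,
  with row numbers taken from \<open>R\<close>.\<close>

definition row_selections :: "nat \<Rightarrow> nat \<Rightarrow> int mat \<Rightarrow> nat set \<Rightarrow> int mat set" where
  "row_selections n N H R =
     {choose_rows n N H f | f. inj_on f {..<n} \<and> f ` {..<n} \<subseteq> R}"

text \<open>Row number \<open>1\<close> of \<open>H\<close> is its second row.\<close>

definition recoupling_selections :: "nat \<Rightarrow> nat \<Rightarrow> int mat \<Rightarrow> nat \<Rightarrow> nat \<Rightarrow> int mat set" where
  "recoupling_selections n N H i j =
     {choose_rows n N H f | f. f i = 1 \<and> f j = 1 \<and>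
        inj_on f ({..<n} - {i, j}) \<and> f ` ({..<n} - {i, j}) \<subseteq> {2..<N}}"

section \<open>Pulse sequences\<close>

text \<open>A sequence lists its steps in temporal order; \<open>Pulse k\<close> is the operator \<open>X\<close> on
  qubit \<open>k\<close>, and \<open>Evolve t\<close> is a time interval of duration \<open>t\<close> under the Hamiltonian.\<close>

datatype step = is_Pulse: Pulse nat | is_Evolve: Evolve real

fun step_op :: "nat \<Rightarrow> complex mat \<Rightarrow> step \<Rightarrow> complex mat" where
  "step_op n Ham (Pulse k) = X_on n k"
| "step_op n Ham (Evolve t) = evolution Ham t"

fun seq_op :: "nat \<Rightarrow> complex mat \<Rightarrow> step list \<Rightarrow> complex mat" where
  "seq_op n Ham [] = 1\<^sub>m (2 ^ n)"
| "seq_op n Ham (s # ss) = seq_op n Ham ss * step_op n Ham s"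

definition num_pulses :: "step list \<Rightarrow> nat" where
  "num_pulses ss = length (filter is_Pulse ss)"

definition num_intervals :: "step list \<Rightarrow> nat" where
  "num_intervals ss = length (filter is_Evolve ss)"

definition pulses :: "nat \<Rightarrow> int mat \<Rightarrow> nat \<Rightarrow> step list" where
  "pulses n S a = map Pulse (filter (\<lambda>k. S $$ (k, a) = -1) [0..<n])"

definition sequence_of :: "nat \<Rightarrow> nat \<Rightarrow> int mat \<Rightarrow> real \<Rightarrow> step list" where
  "sequence_of n N S t = concat (map (\<lambda>a. pulses n S a @ [Evolve t] @ pulses n S a) [0..<N])"

text \<open>Pulses between the same two time intervals are simultaneous, so their order in the list
  is immaterial when looking for adjacent equal pulses.\<close>

inductive cancels_to :: "step list \<Rightarrow> step list \<Rightarrow> bool" where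
  refl: "cancels_to ss ss"
| reorder: "cancels_to ss (us @ Pulse k # Pulse l # vs) \<Longrightarrow>
            cancels_to ss (us @ Pulse l # Pulse k # vs)"
| cancel: "cancels_to ss (us @ Pulse k # Pulse k # vs) \<Longrightarrow> cancels_to ss (us @ vs)"

end

theory Submission
  imports Defs
begin

text \<open>Both Hamiltonians are diagonal in the computational basis, where conjugation by \<open>X\<close> on
  qubit \<open>k\<close> only changes the sign of \<open>Z\<^sup>(\<^sup>k\<^sup>)\<close>. Hence the \<open>a\<close>-th segment evolves under the
  Hamiltonian with \<open>Z\<^sup>(\<^sup>k\<^sup>)\<close> replaced by \<open>S\<^sub>k\<^sub>a Z\<^sup>(\<^sup>k\<^sup>)\<close>; these commute, so the whole sequence is the
  exponential of their sum, in which \<open>\<omega>\<^sub>i\<close> is multiplied by the \<open>i\<close>-th row sum of \<open>S\<close> and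
  \<open>g\<^sub>i\<^sub>j\<close> by the inner product of rows \<open>i\<close> and \<open>j\<close>. For the pulse count, qubit \<open>k\<close> needs one pulse per
  sign change of row \<open>k\<close> extended by \<open>+1\<close> at both ends; this is an even number at most \<open>N + 1\<close>,
  hence at most \<open>N\<close>, since Hadamard orders \<open>\<ge> 2\<close> are even.\<close>

section \<open>Hadamard matrices\<close>

lemma hadamard_iff:
  "hadamard N H \<longleftrightarrow> H \<in> carrier_mat N N \<and>
     (\<forall>r<N. \<forall>c<N. H $$ (r, c) \<in> {1, -1}) \<and>
     (\<forall>r<N. \<forall>s<N. (\<Sum>c<N. H $$ (r, c) * H $$ (s, c)) = (if r = s then int N else 0))"
proof -
  have "H * transpose_mat H = int N \<cdot>\<^sub>m 1\<^sub>m N \<longleftrightarrow>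
      (\<forall>r<N. \<forall>s<N. (\<Sum>c<N. H $$ (r, c) * H $$ (s, c)) = (if r = s then int N else 0))"
    if "H \<in> carrier_mat N N"
    using that by (auto simp: mat_eq_iff scalar_prod_def lessThan_atLeast0)
  then show ?thesis
    unfolding hadamard_def by blast
qed

lemma hadamard_imp_normalized:
  assumes H: "hadamard N H"
  shows "\<exists>H'. normalized_hadamard N H'"
proof -
  \<comment> \<open>Row \<open>r\<close> is scaled by \<open>H $$ (r, 0)\<close> and column
    \<open>c\<close> by \<open>H $$ (0, c)\<close>; without the further factor
    \<open>H $$ (0, 0)\<close> the first row and column would be constantly equal to that
    sign.\<close>
  define H' where
    "H' = mat N N (\<lambda>(r, c). H $$ (0, 0) * H $$ (r, 0) * (H $$ (0, c) * H $$ (r, c)))"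
  have pm: "H $$ (r, c) = 1 \<or> H $$ (r, c) = -1" if "r < N" "c < N" for r c
    using H that by (auto simp: hadamard_iff)
  have orth: "(\<Sum>c<N. H' $$ (r, c) * H' $$ (s, c)) = (if r = s then int N else 0)"
    if rs: "r < N" "s < N" for r s
  proof -
    have "(\<Sum>c<N. H' $$ (r, c) * H' $$ (s, c))
        = (\<Sum>c<N. H $$ (r, 0) * H $$ (s, 0) * (H $$ (r, c) * H $$ (s, c)))"
    proof (rule sum.cong)
      fix c assume "c \<in> {..<N}"
      then show "H' $$ (r, c) * H' $$ (s, c) = H $$ (r, 0) * H $$ (s, 0) * (H $$ (r, c) * H $$ (s, c))"
        using rs pm[of 0 0] pm[of 0 c] by (auto simp: H'_def)
    qed simp
    also have "\<dots> = H $$ (r, 0) * H $$ (s, 0) * (\<Sum>c<N. H $$ (r, c) * H $$ (s, c))"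
      by (simp add: sum_distrib_left)
    also have "\<dots> = H $$ (r, 0) * H $$ (s, 0) * (if r = s then int N else 0)"
      using H rs by (simp add: hadamard_iff)
    also have "\<dots> = (if r = s then int N else 0)"
    proof -
      have "H $$ (s, 0) = 1 \<or> H $$ (s, 0) = -1"
        using rs by (intro pm) auto
      then show ?thesis by auto
    qed
    finally show ?thesis .
  qed
  have unit: "H' $$ (r, c) \<in> {1, -1}" if "r < N" "c < N" for r c
    using that pm[of 0 0] pm[of r 0] pm[of 0 c] pm[of r c] by (auto simp: H'_def)
  have "hadamard N H'"
    using orth unit by (auto simp: hadamard_iff H'_def)
  moreover have "H' $$ (0, c) = 1" if "c < N" for c
    using that pm[of 0 0] pm[of 0 c] by (auto simp: H'_def)
  moreover have "H' $$ (r, 0) = 1" if "r < N" for r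
    using that pm[of 0 0] pm[of r 0] by (auto simp: H'_def)
  ultimately show ?thesis
    unfolding normalized_hadamard_def by blast
qed

text \<open>Orthogonality of the first two rows makes \<open>N\<close> a sum of terms
  \<open>1 + H $$ (0, c) * H $$ (1, c)\<close>, each 0 or 2.\<close>

lemma even_hadamard_order:
  assumes H: "hadamard N H" and N: "N \<ge> 2"
  shows "even N"
proof -
  have "(\<Sum>c<N. H $$ (0, c) * H $$ (1, c)) = 0"
    using H N by (auto simp: hadamard_iff)
  then have "int N = (\<Sum>c<N. 1 + H $$ (0, c) * H $$ (1, c))"
    by (simp add: sum.distrib)
  moreover have "even (\<Sum>c<N. 1 + H $$ (0, c) * H $$ (1, c))"
  proof (intro dvd_sum)
    fix c assume "c \<in> {..<N}"
    then have "H $$ (0, c) \<in> {1, -1}" "H $$ (1, c) \<in> {1, -1}"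
      using H N by (auto simp: hadamard_iff)
    then show "even (1 + H $$ (0, c) * H $$ (1, c))"
      by auto
  qed
  ultimately have "even (int N)"
    by simp
  then show ?thesis
    by simp
qed

text \<open>Row 0 is all ones, so a row sum is the inner product with row 0.\<close>

lemma normalized_hadamard_row_sum:
  assumes "normalized_hadamard N H" "0 < r" "r < N"
  shows "(\<Sum>c<N. H $$ (r, c)) = 0"
proof -
  have "(\<Sum>c<N. H $$ (r, c)) = (\<Sum>c<N. H $$ (r, c) * H $$ (0, c))"
    using assms by (intro sum.cong) (auto simp: normalized_hadamard_def)
  also have "\<dots> = 0"
    using assms by (auto simp: normalized_hadamard_def hadamard_iff)
  finally show ?thesis .
qed

section \<open>Kronecker products of Hadamard matrices and Sylvester's matrices\<close>

lemma sum_div_mod: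
  fixes f :: "nat \<Rightarrow> nat \<Rightarrow> 'a::comm_monoid_add"
  assumes "0 < M"
  shows "(\<Sum>c<N * M. f (c div M) (c mod M)) = (\<Sum>a<N. \<Sum>b<M. f a b)"
proof -
  have "(\<Sum>c<N * M. f (c div M) (c mod M))
      = (\<Sum>a<N. \<Sum>c\<in>{a * M..<a * M + M}. f (c div M) (c mod M))"
    by (rule sum.nat_group[symmetric])
  also have "\<dots> = (\<Sum>a<N. \<Sum>b<M. f a b)"
  proof (rule sum.cong)
    fix a
    have "(\<Sum>c\<in>{a * M..<a * M + M}. f (c div M) (c mod M))
        = (\<Sum>b\<in>{0..<M}. f ((b + a * M) div M) ((b + a * M) mod M))"
      using sum.shift_bounds_nat_ivl[of "\<lambda>c. f (c div M) (c mod M)" 0 "a * M" M]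
      by (simp add: add.commute)
    then show "(\<Sum>c\<in>{a * M..<a * M + M}. f (c div M) (c mod M)) = (\<Sum>b<M. f a b)"
      using assms by (simp add: lessThan_atLeast0)
  qed simp
  finally show ?thesis .
qed

text \<open>The inner product of two rows of \<open>kron A B\<close> factors into one for
  \<open>A\<close> and one for \<open>B\<close>; it can be nonzero only if the row indices agree in
  both quotient and remainder.\<close>

lemma hadamard_kron:
  assumes A: "hadamard N A" and B: "hadamard M B"
  shows "hadamard (N * M) (kron A B)"
proof (cases "M = 0")
  case True
  then show ?thesis
    using A B by (auto simp: hadamard_iff kron_def)
next
  case False
  then have M: "0 < M" by simp
  have dims: "dim_row A = N" "dim_col A = N" "dim_row B = M" "dim_col B = M"
    using A B by (auto simp: hadamard_iff)
  have bnd: "r div M < N" "r mod M < M" if "r < N * M" for r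
    using that M by (auto simp: less_mult_imp_div_less)
  have entry: "kron A B $$ (r, c) = A $$ (r div M, c div M) * B $$ (r mod M, c mod M)"
    if "r < N * M" "c < N * M" for r c
    using that by (simp add: kron_def dims)
  have unit: "kron A B $$ (r, c) \<in> {1, -1}" if "r < N * M" "c < N * M" for r c
  proof -
    have "A $$ (r div M, c div M) \<in> {1, -1}" "B $$ (r mod M, c mod M) \<in> {1, -1}"
      using A B bnd that by (auto simp: hadamard_iff)
    then show ?thesis
      using that by (auto simp: entry)
  qed
  have orth: "(\<Sum>c<N * M. kron A B $$ (r, c) * kron A B $$ (s, c))
      = (if r = s then int (N * M) else 0)" if rs: "r < N * M" "s < N * M" for r s
  proof -
    have "(\<Sum>c<N * M. kron A B $$ (r, c) * kron A B $$ (s, c))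
        = (\<Sum>c<N * M. (A $$ (r div M, c div M) * A $$ (s div M, c div M)) *
            (B $$ (r mod M, c mod M) * B $$ (s mod M, c mod M)))"
      using rs by (intro sum.cong) (auto simp: entry)
    also have "\<dots> = (\<Sum>a<N. \<Sum>b<M. (A $$ (r div M, a) * A $$ (s div M, a)) *
            (B $$ (r mod M, b) * B $$ (s mod M, b)))"
      by (rule sum_div_mod[OF M])
    also have "\<dots> = (\<Sum>a<N. A $$ (r div M, a) * A $$ (s div M, a)) *
        (\<Sum>b<M. B $$ (r mod M, b) * B $$ (s mod M, b))"
      by (simp add: sum_product)
    also have "\<dots> = (if r div M = s div M then int N else 0) *
        (if r mod M = s mod M then int M else 0)"
      using A B bnd rs by (simp add: hadamard_iff)
    also have "\<dots> = (if r = s then int (N * M) else 0)"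
      by (auto, metis div_mult_mod_eq)
    finally show ?thesis .
  qed
  show ?thesis
    using unit orth by (auto simp: hadamard_iff kron_def dims)
qed

lemma hadamard_sylvester: "hadamard (2 ^ r) (sylvester r)"
proof (induction r)
  case 0
  then show ?case by (auto simp: hadamard_iff sylvester_def)
next
  case (Suc r)
  have "hadamard 2 (mat_of_rows_list 2 [[1, 1], [1, -1]])"
    by (auto simp: hadamard_iff mat_of_rows_list_def less_2_cases_iff lessThan_Suc numeral_2_eq_2 less_Suc_eq)
  from hadamard_kron[OF Suc this] show ?case
    by (simp add: sylvester_def mult.commute)
qed

section \<open>Bounds on the least known order\<close>

lemma ex_power_of_two_between:
  fixes n :: nat
  assumes "1 \<le> n"
  shows "\<exists>r. n \<le> 2 ^ r \<and> 2 ^ r < 2 * n"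
  using assms
proof (induction n rule: dec_induct)
  case base
  show ?case by (intro exI[of _ 0]) simp
next
  case (step n)
  then obtain r where r: "n \<le> 2 ^ r" "2 ^ r < 2 * n" by blast
  \<comment> \<open>The old exponent still works unless \<open>n\<close> is itself that power; then
    the next power is \<open>2 * n\<close>, which lies below \<open>2 * Suc n\<close>.\<close>
  show ?case
  proof (cases "n = 2 ^ r")
    case True
    then show ?thesis by (intro exI[of _ "Suc r"]) auto
  next
    case False
    then show ?thesis using r by (intro exI[of _ r]) auto
  qed
qed

text \<open>A Sylvester order between \<open>n\<close> and \<open>2 * n\<close> shows that the least
  element exists, and bounds it.\<close>

lemma nbar_props:
  assumes "\<And>r. sylvester r \<in> K" "1 \<le> n"
  shows "n \<le> nbar K n" "known_order K (nbar K n)" "nbar K n < 2 * n"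
proof -
  obtain r where r: "n \<le> 2 ^ r" "2 ^ r < 2 * n"
    using ex_power_of_two_between assms(2) by blast
  have P: "n \<le> 2 ^ r \<and> known_order K (2 ^ r)"
    using r assms(1) hadamard_sylvester by (auto simp: known_order_def)
  have "n \<le> nbar K n \<and> known_order K (nbar K n)"
    unfolding nbar_def by (rule LeastI[of "\<lambda>N. n \<le> N \<and> known_order K N", OF P])
  then show "n \<le> nbar K n" "known_order K (nbar K n)"
    by auto
  have "nbar K n \<le> 2 ^ r"
    unfolding nbar_def by (rule Least_le[of "\<lambda>N. n \<le> N \<and> known_order K N", OF P])
  then show "nbar K n < 2 * n"
    using r by simp
qed

section \<open>The computational basis\<close>

text \<open>The recursion mirrors that of \<^const>\<open>tensor\<close>: the last qubit is the least significant bit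
  of a basis index.\<close>

fun zsign :: "nat \<Rightarrow> nat \<Rightarrow> nat \<Rightarrow> complex" where
  "zsign 0 k r = 1"
| "zsign (Suc n) k r = (if k = n then (if even r then 1 else -1) else zsign n k (r div 2))"

fun flip :: "nat \<Rightarrow> nat \<Rightarrow> nat \<Rightarrow> nat" where
  "flip 0 k r = r"
| "flip (Suc n) k r =
     (if k = n then 2 * (r div 2) + (1 - r mod 2) else 2 * flip n k (r div 2) + r mod 2)"

lemma odd_pred_div_2 [simp]: "odd r \<Longrightarrow> (r - Suc 0) div 2 = r div 2" for r :: nat
  by presburger

text \<open>Basis form of the fact that \<open>X\<close> anticommutes with \<open>Z\<close> on the
  same qubit and commutes with \<open>Z\<close> on any other.\<close>

lemma zsign_flip:
  "l < n \<Longrightarrow> zsign n l (flip n k r) = (if l = k then - zsign n l r else zsign n l r)"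
  by (induction n k r arbitrary: l rule: flip.induct) (auto simp: mod2_eq_if)

lemma flip_flip [simp]: "flip n k (flip n k r) = r"
  by (induction n k r rule: flip.induct) (auto simp: mod2_eq_if)

lemma flip_commute: "flip n k (flip n l r) = flip n l (flip n k r)"
  by (induction n k r arbitrary: l rule: flip.induct) (auto simp: mod2_eq_if)

lemma flip_less: "r < 2 ^ n \<Longrightarrow> flip n k r < 2 ^ n"
  by (induction n k r rule: flip.induct) (auto simp: mod2_eq_if, linarith+)

section \<open>Tensor products of Pauli matrices as diagonal and permutation matrices\<close>

lemma carrier_kron [simp]:
  "A \<in> carrier_mat a b \<Longrightarrow> B \<in> carrier_mat c d \<Longrightarrow> kron A B \<in> carrier_mat (a * c) (b * d)"
  by (auto simp: kron_def)

lemma tensor_carrier: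
  "(\<And>k. k < n \<Longrightarrow> A k \<in> carrier_mat 2 2) \<Longrightarrow> tensor n A \<in> carrier_mat (2 ^ n) (2 ^ n)"
proof (induction n)
  case (Suc n)
  then have "kron (tensor n A) (A n) \<in> carrier_mat (2 ^ n * 2) (2 ^ n * 2)"
    by (intro carrier_kron) auto
  then show ?case by (simp add: mult.commute)
qed auto

lemma tensor_Suc_entry:
  assumes "\<And>k. A k \<in> carrier_mat 2 2" "r < 2 ^ Suc n" "c < 2 ^ Suc n"
  shows "tensor (Suc n) A $$ (r, c) = tensor n A $$ (r div 2, c div 2) * A n $$ (r mod 2, c mod 2)"
proof -
  have "tensor n A \<in> carrier_mat (2 ^ n) (2 ^ n)" "A n \<in> carrier_mat 2 2"
    using assms(1) tensor_carrier by auto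
  then show ?thesis
    using assms(2,3) by (simp add: kron_def mult.commute)
qed

lemma pauli_carrier [simp]: "pauli_X \<in> carrier_mat 2 2" "pauli_Z \<in> carrier_mat 2 2"
  by (auto simp: pauli_X_def pauli_Z_def mat_of_rows_list_def)

lemma pauli_X_entry: "a < 2 \<Longrightarrow> b < 2 \<Longrightarrow> pauli_X $$ (a, b) = (if a = b then 0 else 1)"
  by (auto simp: pauli_X_def mat_of_rows_list_def less_2_cases_iff)

lemma pauli_Z_entry:
  "a < 2 \<Longrightarrow> b < 2 \<Longrightarrow> pauli_Z $$ (a, b) = (if a = b then if a = 0 then 1 else -1 else 0)"
  by (auto simp: pauli_Z_def mat_of_rows_list_def less_2_cases_iff)

lemma nat_eq_iff_div_mod_2: "r = c \<longleftrightarrow> r div 2 = c div 2 \<and> r mod 2 = c mod 2" for r c :: nat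
  by (metis div_mult_mod_eq)

text \<open>The predicate \<open>P\<close> lets one induction serve both \<open>Z_on\<close> and
  \<open>ZZ_on\<close>: tensor products of diagonal matrices are diagonal, and their eigenvalues
  multiply.\<close>

lemma tensor_Z_entry:
  assumes "r < 2 ^ n" "c < 2 ^ n"
  shows "tensor n (\<lambda>l. if P l then pauli_Z else 1\<^sub>m 2) $$ (r, c)
    = (if r = c then \<Prod>k<n. if P k then zsign n k r else 1 else 0)"
  using assms
proof (induction n arbitrary: r c)
  case (Suc n)
  have IH: "tensor n (\<lambda>l. if P l then pauli_Z else 1\<^sub>m 2) $$ (r div 2, c div 2)
      = (if r div 2 = c div 2 then \<Prod>k<n. if P k then zsign n k (r div 2) else 1 else 0)"
    using Suc.prems by (intro Suc.IH) auto
  have "(\<Prod>k<n. if P k then zsign (Suc n) k r else 1) = (\<Prod>k<n. if P k then zsign n k (r div 2) else 1)"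
    by (intro prod.cong) auto
  moreover have "r mod 2 < 2" "c mod 2 < 2"
    by auto
  ultimately show ?case
    by (subst tensor_Suc_entry)
      (use Suc.prems in \<open>auto simp: IH pauli_Z_entry nat_eq_iff_div_mod_2[of r c] even_iff_mod_2_eq_zero\<close>)
qed auto

lemma Z_on_eq:
  assumes "i < n"
  shows "Z_on n i = mat_diag (2 ^ n) (zsign n i)"
proof -
  have "Z_on n i \<in> carrier_mat (2 ^ n) (2 ^ n)"
    unfolding Z_on_def by (intro tensor_carrier) auto
  moreover have "Z_on n i $$ (r, c) = (if r = c then zsign n i r else 0)"
    if "r < 2 ^ n" "c < 2 ^ n" for r c
    using assms tensor_Z_entry[OF that, of "\<lambda>l. l = i"] by (simp add: Z_on_def)
  ultimately show ?thesis
    by (intro eq_matI) (auto simp: mat_diag_def)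
qed

lemma ZZ_on_eq:
  assumes "i < n" "j < n" "i \<noteq> j"
  shows "ZZ_on n i j = mat_diag (2 ^ n) (\<lambda>r. zsign n i r * zsign n j r)"
proof -
  \<comment> \<open>As \<open>i \<noteq> j\<close>, the product over all qubits separates into two,
    each reducing to a single factor.\<close>
  have split: "(if k = i \<or> k = j then zsign n k r else 1)
      = (if k = i then zsign n k r else 1) * (if k = j then zsign n k r else 1)" for k r
    using assms by auto
  have "ZZ_on n i j \<in> carrier_mat (2 ^ n) (2 ^ n)"
    unfolding ZZ_on_def by (intro tensor_carrier) auto
  moreover have "ZZ_on n i j $$ (r, c) = (if r = c then zsign n i r * zsign n j r else 0)"
    if "r < 2 ^ n" "c < 2 ^ n" for r c
    using assms tensor_Z_entry[OF that, of "\<lambda>l. l = i \<or> l = j"]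
    by (simp add: ZZ_on_def split prod.distrib)
  ultimately show ?thesis
    by (intro eq_matI) (auto simp: mat_diag_def)
qed

text \<open>The 1 of row \<open>r\<close> stands in column \<open>f r\<close>, so a left factor
  \<open>perm_mat d f\<close> picks row \<open>f r\<close> of the right factor, and composition
  reverses the order.\<close>

definition perm_mat :: "nat \<Rightarrow> (nat \<Rightarrow> nat) \<Rightarrow> complex mat" where
  "perm_mat d f = mat d d (\<lambda>(r, c). if c = f r then 1 else 0)"

lemma perm_mat_carrier [simp]: "perm_mat d f \<in> carrier_mat d d"
  by (simp add: perm_mat_def)

text \<open>On basis indices \<open>X\<close> flips one bit. For \<open>k \<ge> n\<close> no tensor
  factor is \<open>pauli_X\<close>, and \<open>flip n k\<close> is the identity too.\<close>

lemma X_on_eq: "X_on n k = perm_mat (2 ^ n) (flip n k)"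
proof -
  have carrier: "X_on n k \<in> carrier_mat (2 ^ n) (2 ^ n)"
    unfolding X_on_def by (intro tensor_carrier) auto
  have "tensor n (\<lambda>l. if l = k then pauli_X else 1\<^sub>m 2) $$ (r, c) = (if c = flip n k r then 1 else 0)"
    if "r < 2 ^ n" "c < 2 ^ n" for r c
    using that
  proof (induction n arbitrary: r c)
    case (Suc n)
    have IH: "tensor n (\<lambda>l. if l = k then pauli_X else 1\<^sub>m 2) $$ (r div 2, c div 2)
        = (if c div 2 = flip n k (r div 2) then 1 else 0)"
      using Suc.prems by (intro Suc.IH) auto
    \<comment> \<open>If the new last qubit is the one flipped, the other factors are identities,
      which the induction hypothesis expresses through \<open>flip n n\<close>.\<close>
    have "flip n n r = r" for r
    proof -
      have "flip m l r = r" if "m \<le> l" for m l r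
        using that by (induction m arbitrary: r) auto
      then show ?thesis by simp
    qed
    then show ?case
      by (subst tensor_Suc_entry)
        (use Suc.prems in \<open>auto simp: IH pauli_X_entry nat_eq_iff_div_mod_2[of c] mod2_eq_if\<close>)
  qed auto
  then show ?thesis
    using carrier by (intro eq_matI) (auto simp: X_on_def perm_mat_def)
qed

lemma perm_mat_mult:
  assumes "A \<in> carrier_mat d d" "\<And>r. r < d \<Longrightarrow> f r < d"
  shows "perm_mat d f * A = mat d d (\<lambda>(r, c). A $$ (f r, c))"
proof (rule eq_matI)
  fix r c
  assume "r < dim_row (mat d d (\<lambda>(r, c). A $$ (f r, c)))"
    "c < dim_col (mat d d (\<lambda>(r, c). A $$ (f r, c)))"
  then have rc: "r < d" "c < d" by auto
  have "(perm_mat d f * A) $$ (r, c) = (\<Sum>x<d. (if x = f r then 1 else 0) * A $$ (x, c))"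
    using rc assms by (simp add: perm_mat_def scalar_prod_def lessThan_atLeast0)
  also have "\<dots> = A $$ (f r, c)"
    using rc assms by (simp add: if_distrib[of "\<lambda>x. x * _"] cong: if_cong)
  finally show "(perm_mat d f * A) $$ (r, c) = mat d d (\<lambda>(r, c). A $$ (f r, c)) $$ (r, c)"
    using rc by simp
qed (use assms in \<open>auto simp: perm_mat_def\<close>)

lemma perm_mat_comp:
  assumes "\<And>r. r < d \<Longrightarrow> f r < d"
  shows "perm_mat d f * perm_mat d h = perm_mat d (h \<circ> f)"
  using assms by (subst perm_mat_mult) (auto simp: perm_mat_def)

text \<open>The left factor moves row \<open>f r\<close> to row \<open>r\<close>; as
  \<open>f\<close> is an involution, the right factor brings its entry back to the diagonal.\<close>

lemma perm_mat_conj_diag: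
  assumes "\<And>r. r < d \<Longrightarrow> f r < d" "\<And>r. f (f r) = r"
  shows "perm_mat d f * (mat_diag d h * perm_mat d f) = mat_diag d (h \<circ> f)"
proof -
  have "perm_mat d f * (mat_diag d h * perm_mat d f)
      = perm_mat d f * mat d d (\<lambda>(r, c). h r * perm_mat d f $$ (r, c))"
    by (simp add: mat_diag_mult_left[of _ d d])
  also have "\<dots> = mat_diag d (h \<circ> f)"
    using assms by (subst perm_mat_mult) (auto simp: perm_mat_def mat_diag_def)
  finally show ?thesis .
qed

section \<open>Diagonal Hamiltonians\<close>

text \<open>Powers act entrywise on the diagonal, so each diagonal entry sums an exponential series
  and every other entry sums zeros.\<close>

lemma mat_exp_diag: "mat_exp (mat_diag d h) = mat_diag d (\<lambda>r. exp (h r))"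
proof -
  have pow: "mat_diag d h ^\<^sub>m k = mat_diag d (\<lambda>r. h r ^ k)" for k
    by (induction k) (simp_all add: carrier_matD(1)[OF mat_diag_dim] mult.commute)
  have "(\<Sum>k. x ^ k / fact k) = exp x" for x :: complex
    by (simp add: exp_def scaleR_conv_of_real divide_inverse mult.commute)
  then show ?thesis
    unfolding mat_exp_def pow by (intro eq_matI) (auto simp: mat_diag_def)
qed

lemma smult_mat_diag: "a \<cdot>\<^sub>m mat_diag d h = mat_diag d (\<lambda>r. a * h r)"
  for a :: complex
  by (intro eq_matI) (auto simp: mat_diag_def)

lemma evolution_diag:
  "evolution (mat_diag d h) t = mat_diag d (\<lambda>r. exp (- \<i> * complex_of_real t * h r))"
  by (simp add: evolution_def smult_mat_diag mat_exp_diag)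

text \<open>Taking the spin values \<open>z\<close> as argument, not a basis index, lets pulses act
  by changing signs of \<open>z\<close>.\<close>

definition spin_energy ::
    "nat \<Rightarrow> (nat \<Rightarrow> real) \<Rightarrow> (nat \<Rightarrow> nat \<Rightarrow> real) \<Rightarrow> (nat \<Rightarrow> complex) \<Rightarrow> complex" where
  "spin_energy n \<omega> g z = - (\<Sum>i<n. complex_of_real (\<omega> i) * z i) / 2
     + (\<Sum>(i, j)\<in>{(i, j). i < j \<and> j < n}. complex_of_real (g i j) * (z i * z j))"

lemma ham_diag:
  "ham_Z n \<omega> + ham_c n g = mat_diag (2 ^ n) (\<lambda>r. spin_energy n \<omega> g (\<lambda>k. zsign n k r))"
proof (rule eq_matI)
  fix r c
  let ?D = "mat_diag (2 ^ n) (\<lambda>r. spin_energy n \<omega> g (\<lambda>k. zsign n k r))"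
  assume "r < dim_row ?D" "c < dim_col ?D"
  then have rc: "r < 2 ^ n" "c < 2 ^ n" by (auto simp: mat_diag_def)
  have "(\<Sum>i<n. (complex_of_real (\<omega> i) \<cdot>\<^sub>m Z_on n i) $$ (r, c))
      = (\<Sum>i<n. if r = c then complex_of_real (\<omega> i) * zsign n i r else 0)"
    using rc by (intro sum.cong) (auto simp: Z_on_eq mat_diag_def)
  moreover have "(\<Sum>x\<in>{(i, j). i < j \<and> j < n}.
        (case x of (i, j) \<Rightarrow> complex_of_real (g i j) \<cdot>\<^sub>m ZZ_on n i j) $$ (r, c))
      = (\<Sum>x\<in>{(i, j). i < j \<and> j < n}.
        if r = c then case x of (i, j) \<Rightarrow> complex_of_real (g i j) * (zsign n i r * zsign n j r) else 0)"
    using rc by (intro sum.cong) (auto simp: ZZ_on_eq mat_diag_def)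
  ultimately show "(ham_Z n \<omega> + ham_c n g) $$ (r, c) = ?D $$ (r, c)"
    using rc by (simp add: ham_Z_def ham_c_def matsum_def mat_diag_def spin_energy_def)
qed (auto simp: ham_Z_def ham_c_def matsum_def mat_diag_def)

text \<open>Makes pure decoupling the zero-field case of the results about the combined
  Hamiltonian.\<close>

lemma ham_c_conv_zero_field: "ham_c n g = ham_Z n (\<lambda>_. 0) + ham_c n g"
  by (intro eq_matI) (auto simp: ham_Z_def ham_c_def matsum_def Z_on_eq mat_diag_def)

section \<open>Pulse sequences\<close>

lemma step_op_carrier:
  assumes "Ham \<in> carrier_mat (2 ^ n) (2 ^ n)"
  shows "step_op n Ham s \<in> carrier_mat (2 ^ n) (2 ^ n)"
  using assms by (cases s) (auto simp: X_on_eq evolution_def mat_exp_def)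

lemma seq_op_carrier:
  assumes "Ham \<in> carrier_mat (2 ^ n) (2 ^ n)"
  shows "seq_op n Ham ss \<in> carrier_mat (2 ^ n) (2 ^ n)"
  by (induction ss) (auto intro!: mult_carrier_mat step_op_carrier assms)

text \<open>Later steps act from the left, so concatenation reverses the product.\<close>

lemma seq_op_append:
  assumes "Ham \<in> carrier_mat (2 ^ n) (2 ^ n)"
  shows "seq_op n Ham (us @ vs) = seq_op n Ham vs * seq_op n Ham us"
proof (induction us)
  case Nil
  show ?case
    using seq_op_carrier[OF assms, of vs] by simp
next
  case (Cons s us)
  then show ?case
    using assoc_mult_mat[OF seq_op_carrier[OF assms] seq_op_carrier[OF assms] step_op_carrier[OF assms]]
    by simp
qed

lemma flip_foldr_commute: "flip n k (foldr (flip n) ks r) = foldr (flip n) ks (flip n k r)"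
  by (induction ks) (auto simp: flip_commute[of n k])

text \<open>Flips are commuting involutions, so their composites are involutions.\<close>

lemma foldr_flip_involution: "foldr (flip n) ks (foldr (flip n) ks r) = r"
  by (induction ks) (auto simp: flip_foldr_commute[symmetric])

lemma foldr_flip_less: "r < 2 ^ n \<Longrightarrow> foldr (flip n) ks r < 2 ^ n"
  by (induction ks) (auto simp: flip_less)

text \<open>Distinctness keeps two flips of one qubit from undoing each other.\<close>

lemma zsign_foldr_flip:
  assumes "distinct ks" "l < n"
  shows "zsign n l (foldr (flip n) ks r) = (if l \<in> set ks then - zsign n l r else zsign n l r)"
  using assms by (induction ks) (auto simp: zsign_flip)

lemma seq_op_map_Pulse: "seq_op n Ham (map Pulse ks) = perm_mat (2 ^ n) (foldr (flip n) ks)"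
proof (induction ks)
  case Nil
  show ?case by (intro eq_matI) (auto simp: perm_mat_def)
next
  case (Cons k ks)
  then show ?case
    by (simp add: X_on_eq perm_mat_comp foldr_flip_less o_def)
qed

text \<open>The simultaneous pulses form an involutive permutation, and conjugating the diagonal
  evolution by it only reindexes the energies.\<close>

lemma seq_op_conjugated_evolution:
  "seq_op n (mat_diag (2 ^ n) h) (map Pulse ks @ [Evolve t] @ map Pulse ks)
    = mat_diag (2 ^ n) (\<lambda>r. exp (- \<i> * complex_of_real t * h (foldr (flip n) ks r)))"
proof -
  let ?P = "perm_mat (2 ^ n) (foldr (flip n) ks)"
    and ?E = "evolution (mat_diag (2 ^ n) h) t"
  have "?E \<in> carrier_mat (2 ^ n) (2 ^ n)"
    by (simp add: evolution_diag)
  then have "seq_op n (mat_diag (2 ^ n) h) (map Pulse ks @ [Evolve t] @ map Pulse ks)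
      = ?P * (?E * ?P)"
    by (simp add: seq_op_append seq_op_map_Pulse assoc_mult_mat[of _ "2 ^ n" "2 ^ n" _ "2 ^ n" _ "2 ^ n"])
  also have "\<dots> = mat_diag (2 ^ n) (\<lambda>r. exp (- \<i> * complex_of_real t * h (foldr (flip n) ks r)))"
    unfolding evolution_diag
    by (subst perm_mat_conj_diag) (auto simp: foldr_flip_less foldr_flip_involution o_def)
  finally show ?thesis .
qed

lemma sequence_of_Suc:
  "sequence_of n (Suc N) S t = sequence_of n N S t @ pulses n S N @ [Evolve t] @ pulses n S N"
  by (simp add: sequence_of_def)

text \<open>Every segment is diagonal, so multiplying segments adds their exponents.\<close>

lemma seq_op_sequence_of_diag:
  "seq_op n (mat_diag (2 ^ n) h) (sequence_of n N S t)
    = mat_diag (2 ^ n) (\<lambda>r. exp (- \<i> * complex_of_real t *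
        (\<Sum>a<N. h (foldr (flip n) (filter (\<lambda>k. S $$ (k, a) = -1) [0..<n]) r))))"
proof (induction N)
  case 0
  show ?case by (simp add: sequence_of_def)
next
  case (Suc N)
  show ?case
    unfolding sequence_of_Suc
    by (subst seq_op_append)
      (simp_all only: Suc pulses_def seq_op_conjugated_evolution mat_diag_dim mat_diag_diag
        sum.lessThan_Suc distrib_left exp_add mult.commute)
qed

section \<open>Total phase in terms of row sums and row inner products\<close>

lemma spin_energy_cong:
  "(\<And>k. k < n \<Longrightarrow> z k = z' k) \<Longrightarrow> spin_energy n \<omega> g z = spin_energy n \<omega> g z'"
  unfolding spin_energy_def by (auto intro!: arg_cong2[of _ _ _ _ "(+)"] sum.cong)

text \<open>Exchanging sums collects the signs: the field terms, linear in \<open>z\<close>, receive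
  row sums, and the coupling terms, quadratic in \<open>z\<close>, receive inner products of
  rows.\<close>

lemma sum_spin_energy:
  "(\<Sum>a\<in>A. spin_energy n \<omega> g (\<lambda>k. s k a * z k))
    = - (\<Sum>i<n. complex_of_real (\<omega> i) * z i * (\<Sum>a\<in>A. s i a)) / 2
      + (\<Sum>(i, j)\<in>{(i, j). i < j \<and> j < n}. complex_of_real (g i j) * (z i * z j) * (\<Sum>a\<in>A. s i a * s j a))"
proof -
  have "(\<Sum>a\<in>A. \<Sum>i<n. complex_of_real (\<omega> i) * (s i a * z i))
      = (\<Sum>i<n. complex_of_real (\<omega> i) * z i * (\<Sum>a\<in>A. s i a))"
    by (subst sum.swap) (simp add: sum_distrib_left ac_simps)
  moreover have "(\<Sum>a\<in>A. \<Sum>(i, j)\<in>P. complex_of_real (g i j) * (s i a * z i * (s j a * z j)))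
      = (\<Sum>(i, j)\<in>P. complex_of_real (g i j) * (z i * z j) * (\<Sum>a\<in>A. s i a * s j a))" for P
    by (subst sum.swap) (simp add: sum_distrib_left ac_simps case_prod_unfold)
  ultimately show ?thesis
    by (simp add: spin_energy_def sum.distrib sum_subtractf sum_negf flip: sum_divide_distrib)
qed

text \<open>The disjunction in \<open>field\<close> covers both ways of losing the linear terms: no
  field at all, or vanishing row sums.\<close>

lemma seq_op_sequence_of:
  assumes "\<And>k a. k < n \<Longrightarrow> a < N \<Longrightarrow> S $$ (k, a) \<in> {1, -1}"
    and field: "\<And>i. i < n \<Longrightarrow> \<omega> i = 0 \<or> (\<Sum>a<N. S $$ (i, a)) = 0"
  shows "seq_op n (ham_Z n \<omega> + ham_c n g) (sequence_of n N S t)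
    = mat_diag (2 ^ n) (\<lambda>r. exp (- \<i> * complex_of_real t *
        (\<Sum>(i, j)\<in>{(i, j). i < j \<and> j < n}. complex_of_real (g i j) * (zsign n i r * zsign n j r) *
          of_int (\<Sum>a<N. S $$ (i, a) * S $$ (j, a)))))"
proof -
  have "(\<Sum>a<N. spin_energy n \<omega> g (\<lambda>k. zsign n k (foldr (flip n) (filter (\<lambda>k. S $$ (k, a) = -1) [0..<n]) r)))
      = (\<Sum>(i, j)\<in>{(i, j). i < j \<and> j < n}. complex_of_real (g i j) * (zsign n i r * zsign n j r) *
          of_int (\<Sum>a<N. S $$ (i, a) * S $$ (j, a)))" for r
  proof -
    have "(\<Sum>a<N. spin_energy n \<omega> g (\<lambda>k. zsign n k (foldr (flip n) (filter (\<lambda>k. S $$ (k, a) = -1) [0..<n]) r)))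
        = (\<Sum>a<N. spin_energy n \<omega> g (\<lambda>k. of_int (S $$ (k, a)) * zsign n k r))"
    proof (intro sum.cong spin_energy_cong)
      \<comment> \<open>Qubit \<open>k\<close> is flipped during interval \<open>a\<close> exactly
        when its entry is -1, so its spin is multiplied by that entry.\<close>
      fix a k assume "a \<in> {..<N}" "k < n"
      with assms(1)[of k a]
      show "zsign n k (foldr (flip n) (filter (\<lambda>k. S $$ (k, a) = -1) [0..<n]) r)
          = of_int (S $$ (k, a)) * zsign n k r"
        by (auto simp: zsign_foldr_flip)
    qed simp
    also have "(\<Sum>i<n. complex_of_real (\<omega> i) * zsign n i r * (\<Sum>a<N. of_int (S $$ (i, a)))) = 0"
      using field by (intro sum.neutral) (auto simp flip: of_int_sum)
    ultimately show ?thesis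
      unfolding sum_spin_energy by simp
  qed
  then show ?thesis
    by (simp add: ham_diag seq_op_sequence_of_diag)
qed

lemma seq_op_sequence_of_decoupled:
  assumes "\<And>k a. k < n \<Longrightarrow> a < N \<Longrightarrow> S $$ (k, a) \<in> {1, -1}"
    and "\<And>i. i < n \<Longrightarrow> \<omega> i = 0 \<or> (\<Sum>a<N. S $$ (i, a)) = 0"
    and coupling: "\<And>i j. i < j \<Longrightarrow> j < n \<Longrightarrow> (\<Sum>a<N. S $$ (i, a) * S $$ (j, a)) = 0"
  shows "seq_op n (ham_Z n \<omega> + ham_c n g) (sequence_of n N S t) = 1\<^sub>m (2 ^ n)"
proof -
  have "(\<Sum>(i, j)\<in>{(i, j). i < j \<and> j < n}. complex_of_real (g i j) * (zsign n i r * zsign n j r) *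
      of_int (\<Sum>a<N. S $$ (i, a) * S $$ (j, a))) = 0" for r
    using coupling by (intro sum.neutral) (auto simp del: of_int_sum)
  then show ?thesis
    by (simp only: seq_op_sequence_of[OF assms(1,2)] mult_zero_right exp_zero mat_diag_one)
qed

lemma finite_pairs: "finite {(i, j). i < j \<and> j < (n::nat)}"
  by (rule finite_subset[of _ "{..<n} \<times> {..<n}"]) auto

text \<open>Only the pair \<open>(i, j)\<close> survives in the coupling sum, with inner product
  \<open>N\<close>, so the accumulated angle is \<open>g i j * real N * t\<close>.\<close>

lemma seq_op_sequence_of_recoupled:
  assumes "\<And>k a. k < n \<Longrightarrow> a < N \<Longrightarrow> S $$ (k, a) \<in> {1, -1}"
    and "\<And>i. i < n \<Longrightarrow> \<omega> i = 0 \<or> (\<Sum>a<N. S $$ (i, a)) = 0"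
    and coupling: "\<And>k l. k < l \<Longrightarrow> l < n \<Longrightarrow>
      (\<Sum>a<N. S $$ (k, a) * S $$ (l, a)) = (if k = i \<and> l = j then int N else 0)"
    and ij: "i < j" "j < n" and t: "g i j * real N * t = \<phi>"
  shows "seq_op n (ham_Z n \<omega> + ham_c n g) (sequence_of n N S t)
    = mat_exp ((- \<i> * complex_of_real \<phi>) \<cdot>\<^sub>m ZZ_on n i j)"
proof -
  have "complex_of_real t * (\<Sum>(k, l)\<in>{(k, l). k < l \<and> l < n}. complex_of_real (g k l) *
      (zsign n k r * zsign n l r) * of_int (\<Sum>a<N. S $$ (k, a) * S $$ (l, a)))
      = complex_of_real \<phi> * (zsign n i r * zsign n j r)" for r
  proof -
    have "(\<Sum>(k, l)\<in>{(k, l). k < l \<and> l < n}. complex_of_real (g k l) * (zsign n k r * zsign n l r) *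
        of_int (\<Sum>a<N. S $$ (k, a) * S $$ (l, a)))
      = (\<Sum>x\<in>{(k, l). k < l \<and> l < n}.
          if x = (i, j) then complex_of_real (g i j) * (zsign n i r * zsign n j r) * of_nat N else 0)"
      using coupling by (intro sum.cong) (auto simp del: of_int_sum split: if_splits)
    also have "\<dots> = complex_of_real (g i j * real N) * (zsign n i r * zsign n j r)"
      using ij by (simp add: sum.delta[OF finite_pairs])
    finally show ?thesis
      by (simp flip: t)
  qed
  then show ?thesis
    using ij by (simp add: seq_op_sequence_of[OF assms(1,2)] ZZ_on_eq smult_mat_diag mat_exp_diag mult.assoc
        del: of_int_sum)
qed

section \<open>Cancellation of pulses\<close>

lemma cancels_to_append:
  assumes "cancels_to ss us"
  shows "cancels_to (ss @ zs) (us @ zs)"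
  using assms
proof (induction rule: cancels_to.induct)
  case (refl ss)
  show ?case by (rule cancels_to.refl)
next
  case (reorder ss us k l vs)
  then show ?case using cancels_to.reorder[of "ss @ zs" us k l "vs @ zs"] by simp
next
  case (cancel ss us k vs)
  then show ?case using cancels_to.cancel[of "ss @ zs" us k "vs @ zs"] by simp
qed

lemma cancels_to_num_intervals:
  "cancels_to ss us \<Longrightarrow> num_intervals us = num_intervals ss"
  by (induction rule: cancels_to.induct) (auto simp: num_intervals_def)

text \<open>Reordering is sound because the \<open>X\<close> operators commute, and cancelling
  because each squares to the identity.\<close>

lemma cancels_to_seq_op:
  assumes "cancels_to ss us" and Ham: "Ham \<in> carrier_mat (2 ^ n) (2 ^ n)"
  shows "seq_op n Ham us = seq_op n Ham ss"
  using assms(1)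
proof (induction rule: cancels_to.induct)
  case (refl ss)
  show ?case by simp
next
  case (reorder ss us k l vs)
  have "seq_op n Ham (map Pulse [k, l]) = seq_op n Ham (map Pulse [l, k])"
    unfolding seq_op_map_Pulse by (simp add: fun_eq_iff flip_commute[of n k] o_def)
  then have "seq_op n Ham (us @ map Pulse [l, k] @ vs) = seq_op n Ham (us @ map Pulse [k, l] @ vs)"
    by (simp only: seq_op_append[OF Ham])
  then show ?case using reorder by simp
next
  case (cancel ss us k vs)
  have "seq_op n Ham (map Pulse [k, k]) = seq_op n Ham (map Pulse [])"
    unfolding seq_op_map_Pulse by (simp add: fun_eq_iff o_def id_def)
  then have "seq_op n Ham (us @ map Pulse [k, k] @ vs) = seq_op n Ham (us @ map Pulse [] @ vs)"
    by (simp only: seq_op_append[OF Ham])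
  then show ?case using cancel by simp
qed

text \<open>Induction from the end of \<open>xs\<close>, since \<open>y\<close> first has to pass
  the last pulse.\<close>

lemma cancels_to_move_front:
  "cancels_to ss (us @ map Pulse xs @ Pulse y # vs) \<Longrightarrow>
    cancels_to ss (us @ Pulse y # map Pulse xs @ vs)"
proof (induction xs arbitrary: vs rule: rev_induct)
  case (snoc x xs)
  then have "cancels_to ss (us @ map Pulse xs @ Pulse y # Pulse x # vs)"
    using cancels_to.reorder[of ss "us @ map Pulse xs" x y vs] by simp
  from snoc.IH[OF this] show ?case by simp
qed simp

text \<open>Each pulse of \<open>ys\<close> in turn is moved to the front and then counted as part
  of \<open>us\<close>.\<close>

lemma cancels_to_permute:
  "cancels_to ss (us @ map Pulse xs @ vs) \<Longrightarrow> mset xs = mset ys \<Longrightarrow>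
    cancels_to ss (us @ map Pulse ys @ vs)"
proof (induction ys arbitrary: us xs)
  case (Cons y ys)
  then have "y \<in> set xs"
    by (metis list.set_intros(1) set_mset_mset)
  then obtain xs1 xs2 where xs: "xs = xs1 @ y # xs2"
    by (meson split_list)
  have "cancels_to ss ((us @ [Pulse y]) @ map Pulse (xs1 @ xs2) @ vs)"
    using Cons.prems(1) cancels_to_move_front[of ss us xs1 y "map Pulse xs2 @ vs"] by (simp add: xs)
  from Cons.IH[OF this] Cons.prems(2) show ?case
    by (simp add: xs)
qed simp

lemma cancels_to_drop_double:
  "cancels_to ss (us @ map Pulse (xs @ xs) @ vs) \<Longrightarrow> cancels_to ss (us @ vs)"
proof (induction xs)
  case (Cons x xs)
  have "cancels_to ss (us @ map Pulse (x # x # xs @ xs) @ vs)"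
    by (rule cancels_to_permute[OF Cons.prems]) simp
  then have "cancels_to ss (us @ map Pulse (xs @ xs) @ vs)"
    using cancels_to.cancel[of ss us x "map Pulse (xs @ xs) @ vs"] by simp
  then show ?case by (rule Cons.IH)
qed simp

text \<open>Applied with \<open>P\<close> marking the closing pulses of one interval and
  \<open>Q\<close> the opening pulses of the next: a qubit in both is pulsed twice, and the two
  pulses cancel.\<close>

lemma cancels_to_symmetric_difference:
  assumes "cancels_to ss (us @ map Pulse (filter P L @ filter Q L) @ vs)"
  shows "cancels_to ss (us @ map Pulse (filter (\<lambda>k. P k \<noteq> Q k) L) @ vs)"
proof -
  let ?R = "filter (\<lambda>k. P k \<and> Q k) L"
  have "mset (filter P L @ filter Q L) = mset (filter (\<lambda>k. P k \<noteq> Q k) L @ ?R @ ?R)"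
    by (induction L) auto
  from cancels_to_permute[OF assms this]
  have "cancels_to ss ((us @ map Pulse (filter (\<lambda>k. P k \<noteq> Q k) L)) @ map Pulse (?R @ ?R) @ vs)"
    by simp
  from cancels_to_drop_double[OF this] show ?thesis by simp
qed

text \<open>\<open>flipped S a k\<close> says that qubit \<open>k\<close> is flipped during the interval preceding boundary \<open>a\<close>;
  at boundary \<open>0\<close> nothing precedes.\<close>

fun flipped :: "int mat \<Rightarrow> nat \<Rightarrow> nat \<Rightarrow> bool" where
  "flipped S 0 k = False"
| "flipped S (Suc a) k = (S $$ (k, a) = -1)"

text \<open>The closing pulses of the last interval are left out, as they still have to be combined
  with the opening pulses of the next.\<close>

fun merged :: "nat \<Rightarrow> nat \<Rightarrow> int mat \<Rightarrow> real \<Rightarrow> step list" where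
  "merged n 0 S t = []"
| "merged n (Suc a) S t = merged n a S t @
     map Pulse (filter (\<lambda>k. flipped S a k \<noteq> flipped S (Suc a) k) [0..<n]) @ [Evolve t]"

lemma pulses_eq_flipped: "pulses n S a = map Pulse (filter (flipped S (Suc a)) [0..<n])"
  unfolding pulses_def by (rule arg_cong[of _ _ "map Pulse"], rule filter_cong) auto

lemma sequence_of_cancels_to_merged:
  "cancels_to (sequence_of n N S t)
    (merged n N S t @ map Pulse (filter (flipped S N) [0..<n]))"
proof (induction N)
  case 0
  show ?case by (simp add: sequence_of_def cancels_to.refl)
next
  case (Suc N)
  have "cancels_to (sequence_of n (Suc N) S t)
      (merged n N S t @ map Pulse (filter (flipped S N) [0..<n] @ filter (flipped S (Suc N)) [0..<n]) @
        [Evolve t] @ pulses n S N)"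
    using cancels_to_append[OF Suc, of "pulses n S N @ [Evolve t] @ pulses n S N"]
    by (simp add: sequence_of_Suc pulses_eq_flipped del: flipped.simps)
  from cancels_to_symmetric_difference[OF this] show ?case
    by (simp add: pulses_eq_flipped del: flipped.simps)
qed

section \<open>Counting the remaining pulses\<close>

lemma length_filter_upt: "length (filter P [0..<n]) = (\<Sum>k<n. of_bool (P k))"
  by (induction n) auto

lemma num_pulses_merged:
  "num_pulses (merged n N S t)
    = (\<Sum>k<n. \<Sum>a<N. of_bool (flipped S a k \<noteq> flipped S (Suc a) k))"
  by (induction N)
    (auto simp: num_pulses_def filter_map o_def length_filter_upt sum.distrib simp del: flipped.simps)

text \<open>The term for \<open>b N\<close> counts a final change back to the initial value
  \<open>False\<close>; a closed path changes value an even number of times.\<close>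

lemma even_sign_changes:
  fixes b :: "nat \<Rightarrow> bool"
  assumes "\<not> b 0"
  shows "even ((\<Sum>a<N. of_bool (b a \<noteq> b (Suc a))) + of_bool (b N) :: nat)"
  using assms by (induction N) auto

text \<open>There are \<open>Suc N\<close> boundaries, and parity excludes a change at every one of
  them.\<close>

lemma sign_changes_le:
  fixes b :: "nat \<Rightarrow> bool"
  assumes "\<not> b 0" "even N"
  shows "(\<Sum>a<N. of_bool (b a \<noteq> b (Suc a))) + of_bool (b N) \<le> N"
proof -
  have "(\<Sum>a<N. of_bool (b a \<noteq> b (Suc a))) \<le> (\<Sum>a<N. 1 :: nat)"
    by (intro sum_mono) auto
  then have "(\<Sum>a<N. of_bool (b a \<noteq> b (Suc a))) + of_bool (b N) \<le> Suc N"
    by auto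
  moreover have "(\<Sum>a<N. of_bool (b a \<noteq> b (Suc a))) + of_bool (b N) \<noteq> Suc N"
    using even_sign_changes[of b N] assms by (metis even_Suc)
  ultimately show ?thesis by linarith
qed

lemma num_intervals_sequence_of: "num_intervals (sequence_of n N S t) = N"
  by (induction N) (auto simp: sequence_of_Suc num_intervals_def pulses_def, simp add: sequence_of_def)

lemma sequence_of_cancels_to_few_pulses:
  assumes "even N" and Ham: "Ham \<in> carrier_mat (2 ^ n) (2 ^ n)"
  shows "\<exists>ss. cancels_to (sequence_of n N S t) ss \<and>
    seq_op n Ham ss = seq_op n Ham (sequence_of n N S t) \<and>
    num_intervals ss = N \<and> num_pulses ss \<le> n * N"
proof (intro exI conjI)
  let ?ss = "merged n N S t @ map Pulse (filter (flipped S N) [0..<n])"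
  show cancels: "cancels_to (sequence_of n N S t) ?ss"
    by (rule sequence_of_cancels_to_merged)
  show "seq_op n Ham ?ss = seq_op n Ham (sequence_of n N S t)"
    by (rule cancels_to_seq_op[OF cancels Ham])
  show "num_intervals ?ss = N"
    using cancels_to_num_intervals[OF cancels] by (simp add: num_intervals_sequence_of)
  \<comment> \<open>Counting by qubit rather than by boundary leaves one number of sign changes per
    qubit, the closing boundary included.\<close>
  have "num_pulses ?ss
      = (\<Sum>k<n. (\<Sum>a<N. of_bool (flipped S a k \<noteq> flipped S (Suc a) k)) + of_bool (flipped S N k))"
    using num_pulses_merged[of n N S t]
    by (simp add: num_pulses_def filter_map o_def length_filter_upt sum.distrib del: flipped.simps)
  also have "\<dots> \<le> (\<Sum>k<n. N)"
    using assms(1) by (intro sum_mono sign_changes_le) auto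
  finally show "num_pulses ?ss \<le> n * N" by simp
qed

section \<open>Row selections\<close>

lemma ham_carrier: "ham_Z n \<omega> + ham_c n g \<in> carrier_mat (2 ^ n) (2 ^ n)"
  by (simp add: ham_diag)

lemma known_order_imp_normalized: "known_order K N \<Longrightarrow> \<exists>H. normalized_hadamard N H"
  using hadamard_imp_normalized by (auto simp: known_order_def)

text \<open>Injectivity of the selection makes different qubits use different, hence orthogonal,
  rows. \<open>R\<close> is general in order to cover selections with and without row 0.\<close>

lemma row_selection_props:
  assumes H: "hadamard N H" and S: "S \<in> row_selections n N H R" and R: "R \<subseteq> {..<N}"
  shows "\<And>k a. k < n \<Longrightarrow> a < N \<Longrightarrow> S $$ (k, a) \<in> {1, -1}"
    and "\<And>i j. i < j \<Longrightarrow> j < n \<Longrightarrow> (\<Sum>a<N. S $$ (i, a) * S $$ (j, a)) = 0"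
proof -
  obtain f where f: "inj_on f {..<n}" "f ` {..<n} \<subseteq> R" "S = choose_rows n N H f"
    using S by (auto simp: row_selections_def)
  have fN: "f k < N" if "k < n" for k
    using f(2) R that by auto
  have entry: "S $$ (k, a) = H $$ (f k, a)" if "k < n" "a < N" for k a
    using that by (simp add: f choose_rows_def)
  show "S $$ (k, a) \<in> {1, -1}" if "k < n" "a < N" for k a
    using H fN[OF that(1)] that unfolding entry[OF that] hadamard_iff by blast
  show "(\<Sum>a<N. S $$ (i, a) * S $$ (j, a)) = 0" if "i < j" "j < n" for i j
  proof -
    have "f i \<noteq> f j"
      using f(1) that by (auto dest: inj_onD)
    then show ?thesis
      using H that fN[of i] fN[of j] by (simp add: entry hadamard_iff)
  qed
qed

lemma row_selection_row_sum:
  assumes H: "normalized_hadamard N H" and S: "S \<in> row_selections n N H {1..<N}" and "i < n"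
  shows "(\<Sum>a<N. S $$ (i, a)) = 0"
proof -
  obtain f where f: "f ` {..<n} \<subseteq> {1..<N}" "S = choose_rows n N H f"
    using S by (auto simp: row_selections_def)
  then have "f i \<in> {1..<N}" using \<open>i < n\<close> by blast
  then show ?thesis
    using normalized_hadamard_row_sum[OF H, of "f i"] \<open>i < n\<close> by (simp add: f choose_rows_def)
qed

lemma row_selections_nonempty: "n < N \<Longrightarrow> row_selections n N H {1..<N} \<noteq> {}"
proof -
  assume "n < N"
  \<comment> \<open>\<open>Suc\<close> assigns rows 1 to \<open>n\<close>, skipping the all-ones row
    0.\<close>
  then have "choose_rows n N H Suc \<in> row_selections n N H {1..<N}"
    unfolding row_selections_def by (intro CollectI exI[of _ Suc]) auto
  then show ?thesis by blast
qed

lemma seq_op_row_selection: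
  assumes "normalized_hadamard N H" "S \<in> row_selections n N H {1..<N}"
  shows "seq_op n (ham_Z n \<omega> + ham_c n g) (sequence_of n N S t) = 1\<^sub>m (2 ^ n)"
proof -
  have H: "hadamard N H"
    using assms(1) by (simp add: normalized_hadamard_def)
  have subset: "{1..<N} \<subseteq> {..<N}"
    by auto
  show ?thesis
    using row_selection_props[OF H assms(2) subset] row_selection_row_sum[OF assms]
    by (intro seq_op_sequence_of_decoupled) auto
qed

text \<open>All chosen rows avoid row 0, so row sums vanish; two qubits share a row only if they are
  \<open>i\<close> and \<open>j\<close>, as the others use distinct rows from number 2 on.\<close>

lemma recoupling_selection_props:
  assumes H: "normalized_hadamard N H" and S: "S \<in> recoupling_selections n N H i j" and "2 \<le> N"
  shows "\<And>k a. k < n \<Longrightarrow> a < N \<Longrightarrow> S $$ (k, a) \<in> {1, -1}"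
    and "\<And>k. k < n \<Longrightarrow> (\<Sum>a<N. S $$ (k, a)) = 0"
    and "\<And>k l. k < l \<Longrightarrow> l < n \<Longrightarrow> i < j \<Longrightarrow>
      (\<Sum>a<N. S $$ (k, a) * S $$ (l, a)) = (if k = i \<and> l = j then int N else 0)"
proof -
  have had: "hadamard N H"
    using H by (simp add: normalized_hadamard_def)
  obtain f where f: "f i = 1" "f j = 1" "inj_on f ({..<n} - {i, j})"
      "f ` ({..<n} - {i, j}) \<subseteq> {2..<N}" "S = choose_rows n N H f"
    using S by (auto simp: recoupling_selections_def)
  have f2: "f k \<in> {2..<N}" if "k < n" "k \<noteq> i" "k \<noteq> j" for k
    using f(4) that by blast
  then have fN: "f k \<in> {1..<N}" if "k < n" for k
    using f(1,2) \<open>2 \<le> N\<close> that by (cases "k = i \<or> k = j") fastforce+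
  have entry: "S $$ (k, a) = H $$ (f k, a)" if "k < n" "a < N" for k a
    using that by (simp add: f choose_rows_def)
  show "S $$ (k, a) \<in> {1, -1}" if "k < n" "a < N" for k a
    using had fN[OF that(1)] that unfolding entry[OF that] hadamard_iff by auto
  show "(\<Sum>a<N. S $$ (k, a)) = 0" if "k < n" for k
    using normalized_hadamard_row_sum[OF H, of "f k"] fN[OF that] that by (simp add: entry)
  show "(\<Sum>a<N. S $$ (k, a) * S $$ (l, a)) = (if k = i \<and> l = j then int N else 0)"
    if kl: "k < l" "l < n" "i < j" for k l
  proof -
    have "f k = f l \<longleftrightarrow> k = i \<and> l = j"
    proof (cases "k \<in> {i, j}"; cases "l \<in> {i, j}")
      assume "k \<notin> {i, j}" "l \<notin> {i, j}"
      then show ?thesis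
        using inj_onD[OF f(3), of k l] kl by auto
    qed (use f(1,2) f2[of k] f2[of l] kl in auto)
    then show ?thesis
      using had kl fN[of k] fN[of l] by (simp add: entry hadamard_iff)
  qed
qed

text \<open>The other \<open>n - 2\<close> qubits inject into the \<open>N - 2\<close> rows numbered
  from 2.\<close>

lemma recoupling_selections_nonempty:
  assumes "i < j" "j < n" "n \<le> N"
  shows "recoupling_selections n N H i j \<noteq> {}"
proof -
  have "card ({..<n} - {i, j}) \<le> card {2..<N}"
    using assms by (simp add: card_Diff_subset)
  then obtain f where f: "f ` ({..<n} - {i, j}) \<subseteq> {2..<N}" "inj_on f ({..<n} - {i, j})"
    using card_le_inj[of "{..<n} - {i, j}" "{2..<N}"] by auto
  define f' where "f' = (\<lambda>k. if k \<in> {i, j} then 1 else f k)"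
  have "inj_on f' ({..<n} - {i, j})"
    using f(2) by (rule inj_on_cong[THEN iffD1, rotated]) (auto simp: f'_def)
  then have "choose_rows n N H f' \<in> recoupling_selections n N H i j"
    unfolding recoupling_selections_def
    using f(1) by (intro CollectI exI[of _ f']) (auto simp: f'_def)
  then show ?thesis by blast
qed

theorem mainTheorem3:
  fixes n N :: nat and K :: "int mat set"
    and \<omega> :: "nat \<Rightarrow> real" and g :: "nat \<Rightarrow> nat \<Rightarrow> real"
  assumes "n \<ge> 2"
    and sylvester_known: "\<And>r. sylvester r \<in> K"
    and N: "N = nbar K n"
  shows "(n \<le> N \<and> known_order K N \<and> N < 2 * n) \<and>
    (\<forall>H S t. hadamard N H \<and> S \<in> row_selections n N H {..<N} \<longrightarrow>
       seq_op n (ham_c n g) (sequence_of n N S t) = 1\<^sub>m (2 ^ n) \<and>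
       num_intervals (sequence_of n N S t) = N \<and>
       (\<exists>ss. cancels_to (sequence_of n N S t) ss \<and>
             seq_op n (ham_c n g) ss = 1\<^sub>m (2 ^ n) \<and>
             num_intervals ss = N \<and> num_pulses ss \<le> n * N)) \<and>
    (n < N \<longrightarrow>
       (\<exists>H. normalized_hadamard N H \<and> row_selections n N H {1..<N} \<noteq> {}) \<and>
       (\<forall>H S t. normalized_hadamard N H \<and> S \<in> row_selections n N H {1..<N} \<longrightarrow>
          seq_op n (ham_Z n \<omega> + ham_c n g) (sequence_of n N S t) = 1\<^sub>m (2 ^ n))) \<and>
    (n = N \<longrightarrow>
       (let M = nbar K (n + 1) in
         n + 1 \<le> M \<and> known_order K M \<and>
         (\<exists>H. normalized_hadamard M H \<and> row_selections n M H {1..<M} \<noteq> {}) \<and>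
         (\<forall>H S t. normalized_hadamard M H \<and> S \<in> row_selections n M H {1..<M} \<longrightarrow>
            seq_op n (ham_Z n \<omega> + ham_c n g) (sequence_of n M S t) = 1\<^sub>m (2 ^ n)))) \<and>
    (\<forall>i j. i < j \<and> j < n \<and> g i j \<noteq> 0 \<longrightarrow>
       (\<exists>H. normalized_hadamard N H \<and> recoupling_selections n N H i j \<noteq> {}) \<and>
       (\<forall>H S t. normalized_hadamard N H \<and> S \<in> recoupling_selections n N H i j \<and>
                g i j * real N * t = pi / 4 \<longrightarrow>
          seq_op n (ham_Z n \<omega> + ham_c n g) (sequence_of n N S t)
            = mat_exp ((- \<i> * complex_of_real (pi / 4)) \<cdot>\<^sub>m ZZ_on n i j) \<and>
          num_intervals (sequence_of n N S t) \<le> N \<and>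
          (\<exists>ss. cancels_to (sequence_of n N S t) ss \<and>
                seq_op n (ham_Z n \<omega> + ham_c n g) ss
                  = mat_exp ((- \<i> * complex_of_real (pi / 4)) \<cdot>\<^sub>m ZZ_on n i j) \<and>
                num_intervals ss \<le> N \<and> num_pulses ss \<le> n * N)))"
proof (intro conjI allI impI; (elim conjE)?)
  have n1: "1 \<le> n" and n2: "1 \<le> n + 1"
    using \<open>n \<ge> 2\<close> by auto
  note nN = nbar_props[of K n, OF sylvester_known n1, folded N]
  show "n \<le> N" "known_order K N" "N < 2 * n"
    by (fact nN)+
  have N2: "2 \<le> N"
    using \<open>n \<ge> 2\<close> nN(1) by simp
  \<comment> \<open>Evenness improves the bound per qubit from \<open>N + 1\<close> pulses to
    \<open>N\<close>.\<close>
  have "even N"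
    using nN(2) even_hadamard_order[OF _ N2] by (auto simp: known_order_def)
  \<comment> \<open>The field \<open>\<omega>'\<close> stays free: decoupling takes it to be zero,
    recoupling takes \<open>\<omega>\<close>.\<close>
  then have few_pulses: "\<exists>ss. cancels_to (sequence_of n N S t) ss \<and>
      seq_op n (ham_Z n \<omega>' + ham_c n g) ss
        = seq_op n (ham_Z n \<omega>' + ham_c n g) (sequence_of n N S t) \<and>
      num_intervals ss = N \<and> num_pulses ss \<le> n * N" for \<omega>' S t
    by (rule sequence_of_cancels_to_few_pulses[OF _ ham_carrier])
  {
    fix H S t
    assume H: "hadamard N H" and S: "S \<in> row_selections n N H {..<N}"
    show decoupled: "seq_op n (ham_c n g) (sequence_of n N S t) = 1\<^sub>m (2 ^ n)"
      using row_selection_props[OF H S]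
      by (subst ham_c_conv_zero_field, intro seq_op_sequence_of_decoupled) auto
    show "num_intervals (sequence_of n N S t) = N"
      by (rule num_intervals_sequence_of)
    show "\<exists>ss. cancels_to (sequence_of n N S t) ss \<and> seq_op n (ham_c n g) ss = 1\<^sub>m (2 ^ n) \<and>
        num_intervals ss = N \<and> num_pulses ss \<le> n * N"
      using few_pulses[of S t "\<lambda>_. 0"] decoupled
      by (simp flip: ham_c_conv_zero_field)
  }
  show "\<exists>H. normalized_hadamard N H \<and> row_selections n N H {1..<N} \<noteq> {}" if "n < N"
    using known_order_imp_normalized[OF nN(2)] row_selections_nonempty[OF that] by blast
  show "seq_op n (ham_Z n \<omega> + ham_c n g) (sequence_of n N S t) = 1\<^sub>m (2 ^ n)"
    if "normalized_hadamard N H" "S \<in> row_selections n N H {1..<N}" for H S t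
    using that by (rule seq_op_row_selection)
  show "let M = nbar K (n + 1) in
         n + 1 \<le> M \<and> known_order K M \<and>
         (\<exists>H. normalized_hadamard M H \<and> row_selections n M H {1..<M} \<noteq> {}) \<and>
         (\<forall>H S t. normalized_hadamard M H \<and> S \<in> row_selections n M H {1..<M} \<longrightarrow>
            seq_op n (ham_Z n \<omega> + ham_c n g) (sequence_of n M S t) = 1\<^sub>m (2 ^ n))"
  proof -
    \<comment> \<open>As \<open>nbar K (n + 1)\<close> exceeds \<open>n\<close>, at least
      \<open>n\<close> rows remain once the first is excluded.\<close>
    note nM = nbar_props[of K "n + 1", OF sylvester_known n2]
    show ?thesis
      using nM known_order_imp_normalized[OF nM(2)] row_selections_nonempty[of n "nbar K (n + 1)"]
        seq_op_row_selection
      by (auto simp: Let_def)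
  qed
  fix i j
  assume ij: "i < j" "j < n"
  show "\<exists>H. normalized_hadamard N H \<and> recoupling_selections n N H i j \<noteq> {}"
    using known_order_imp_normalized[OF nN(2)] recoupling_selections_nonempty[OF ij nN(1)] by blast
  fix H S t
  assume H: "normalized_hadamard N H" and S: "S \<in> recoupling_selections n N H i j"
    and t: "g i j * real N * t = pi / 4"
  show recoupled: "seq_op n (ham_Z n \<omega> + ham_c n g) (sequence_of n N S t)
      = mat_exp ((- \<i> * complex_of_real (pi / 4)) \<cdot>\<^sub>m ZZ_on n i j)"
    using recoupling_selection_props[OF H S N2] ij t
    by (intro seq_op_sequence_of_recoupled) auto
  show "num_intervals (sequence_of n N S t) \<le> N"
    by (simp add: num_intervals_sequence_of)
  from few_pulses[of S t \<omega>, unfolded recoupled]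
  show "\<exists>ss. cancels_to (sequence_of n N S t) ss \<and>
      seq_op n (ham_Z n \<omega> + ham_c n g) ss
        = mat_exp ((- \<i> * complex_of_real (pi / 4)) \<cdot>\<^sub>m ZZ_on n i j) \<and>
      num_intervals ss \<le> N \<and> num_pulses ss \<le> n * N"
    by blast
qed

end
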